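(* Let $n\ge 4$ and let $K_{1,n-1}$ be the star graph with vertex set $\{1,2,\dots,n\}$ and edge set $\{\{1,i\}: i=2,\dots,n\}$. Then $\mathcal{T}_\ell(K_{1,n-1},2)\cong M_3(\mathbb{C})\oplus\mathbb{C}$ as $\mathbb{C}$-algebras for $\ell=1,2,3,4$.
   Context: For a finite connected simple graph $\Gamma=(X,E)$ with adjacency matrix $A$ and base vertex $x_0\in X$, $M_X(\mathbb{C})$ is the algebra of complex matrices with rows and columns indexed by $X$. For $Y\subset X$, $E_Y$ is the diagonal matrix with $(x,x)$-entry $1$ if $x\in Y$ and $0$ otherwise; $E_x=E_{\{x\}}$. $\mathbb{C}\langle S\rangle$ is the unital $\mathbb{C}$-subalgebra of $M_X(\mathbb{C})$ generated by $S$. Let $X_k=\{x\in X:\partial(x_0,x)=k\}$ ($\partial$ the graph distance), $D=\max_{x}\partial(x_0,x)$, $G_{x_0}$ the stabilizer of $x_0$ in $\mathrm{Aut}(\Gamma)$, and $Y_1,\dots,Y_r$ the $G_{x_0}$-orbits on $X$. Then $\mathcal{T}_1(\Gamma,x_0)=\mathbb{C}\langle A,E_{x_0}\rangle$, $\mathcal{T}_2(\Gamma,x_0)=\mathbb{C}\langle A,E_{X_0},\dots,E_{X_D}\rangle$, $\mathcal{T}_3(\Gamma,x_0)=\mathbb{C}\langle A,E_{Y_1},\dots,E_{Y_r}\rangle$, and $\mathcal{T}_4(\Gamma,x_0)=\{M\in M_X(\mathbb{C}): M_{\sigma(x),\sigma(y)}=M_{x,y}\ \text{for all } x,y\in X,\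 \sigma\in G_{x_0}\}$. *)

theory Defs
  imports
    Complex_Main
    "HOL-Algebra.Group_Action"
    "HOL-Algebra.Chinese_Remainder"
    "HOL-Algebra.Module"
    "HOL-Algebra.Subrings"
begin

section \<open>Graphs\<close>

text \<open>A graph is given by its vertex set \<open>X\<close> and its set \<open>E\<close> of edges, which are two-element
  subsets of \<open>X\<close>.\<close>

definition adj_rel :: "'a set set \<Rightarrow> ('a \<times> 'a) set"
  where "adj_rel E = {(u, v). {u, v} \<in> E}"

definition finite_connected_simple_graph :: "'a set \<Rightarrow> 'a set set \<Rightarrow> bool"
  where "finite_connected_simple_graph X E \<longleftrightarrow>
    finite X \<and> X \<noteq> {} \<and> (\<forall>e\<in>E. e \<subseteq> X \<and> card e = 2) \<and>
    (\<forall>x\<in>X. \<forall>y\<in>X. (x, y) \<in> (adj_rel E)\<^sup>*)"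

text \<open>The relational power \<open>adj_rel E ^^ k\<close> relates the endpoints of the walks of length \<open>k\<close>.
  The value is only meaningful for vertices in the same component.\<close>

definition graph_dist :: "'a set set \<Rightarrow> 'a \<Rightarrow> 'a \<Rightarrow> nat"
  where "graph_dist E x y = (LEAST k. (x, y) \<in> adj_rel E ^^ k)"

definition sphere_at :: "'a set \<Rightarrow> 'a set set \<Rightarrow> 'a \<Rightarrow> nat \<Rightarrow> 'a set"
  where "sphere_at X E x0 k = {x \<in> X. graph_dist E x0 x = k}"

definition eccentricity :: "'a set \<Rightarrow> 'a set set \<Rightarrow> 'a \<Rightarrow> nat"
  where "eccentricity X E x0 = Max (graph_dist E x0 ` X)"

text \<open>Automorphisms are elements of \<^const>\<open>BijGroup\<close>, that is, bijections of \<open>X\<close> that are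
  \<^const>\<open>undefined\<close> outside \<open>X\<close>.\<close>

definition aut_group :: "'a set \<Rightarrow> 'a set set \<Rightarrow> ('a \<Rightarrow> 'a) monoid"
  where "aut_group X E = (BijGroup X)
    \<lparr>carrier := {\<sigma> \<in> Bij X. \<forall>x\<in>X. \<forall>y\<in>X. {\<sigma> x, \<sigma> y} \<in> E \<longleftrightarrow> {x, y} \<in> E}\<rparr>"

definition vertex_stabilizer :: "'a set \<Rightarrow> 'a set set \<Rightarrow> 'a \<Rightarrow> ('a \<Rightarrow> 'a) monoid"
  where "vertex_stabilizer X E x0 = (aut_group X E)
    \<lparr>carrier := stabilizer (aut_group X E) (\<lambda>\<sigma>. \<sigma>) x0\<rparr>"

section \<open>Complex algebras\<close>

text \<open>Complex algebras are represented by the record \<^typ>\<open>(complex, 'm) module\<close>. The library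
  locale \<^locale>\<open>algebra\<close> is restricted to commutative algebras and is therefore not used.\<close>

definition alg_iso :: "(complex, 'm) module \<Rightarrow> (complex, 'k) module \<Rightarrow> bool"
    (infix \<open>\<cong>\<^sub>\<C>\<close> 50)
  where "A \<cong>\<^sub>\<C> B \<longleftrightarrow>
    (\<exists>h \<in> ring_iso A B. \<forall>c. \<forall>a \<in> carrier A. h (c \<odot>\<^bsub>A\<^esub> a) = c \<odot>\<^bsub>B\<^esub> h a)"

definition alg_dirsum ::
    "(complex, 'm) module \<Rightarrow> (complex, 'k) module \<Rightarrow> (complex, 'm \<times> 'k) module"
    (infixr \<open>\<oplus>\<^sub>\<C>\<close> 65)
  where "A \<oplus>\<^sub>\<C> B = ring.extend (RDirProd A B)
    (module.fields (\<lambda>c (a, b). (c \<odot>\<^bsub>A\<^esub> a, c \<odot>\<^bsub>B\<^esub> b)))"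

definition complex_alg :: "(complex, complex) module"
  where "complex_alg = \<lparr>carrier = UNIV, monoid.mult = (*), one = 1,
    ring.zero = 0, add = (+), smult = (*)\<rparr>"

text \<open>\<open>mat_alg X\<close> is the full algebra of complex matrices with rows and columns indexed by \<open>X\<close>, represented
  by functions that vanish outside \<open>X \<times> X\<close>.\<close>

definition mat_alg :: "'a set \<Rightarrow> (complex, 'a \<Rightarrow> 'a \<Rightarrow> complex) module"
  where "mat_alg X =
    \<lparr>carrier = {M. \<forall>x y. x \<notin> X \<or> y \<notin> X \<longrightarrow> M x y = 0},
     monoid.mult = (\<lambda>M N x y. \<Sum>z\<in>X. M x z * N z y),
     one = (\<lambda>x y. if x \<in> X \<and> x = y then 1 else 0),
     ring.zero = (\<lambda>x y. 0),
     add = (\<lambda>M N x y. M x y + N x y),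
     smult = (\<lambda>c M x y. c * M x y)\<rparr>"

definition unital_subalgebra :: "'m set \<Rightarrow> (complex, 'm) module \<Rightarrow> bool"
  where "unital_subalgebra B A \<longleftrightarrow>
    subring B A \<and> (\<forall>c. \<forall>b \<in> B. c \<odot>\<^bsub>A\<^esub> b \<in> B)"

definition generated_alg :: "(complex, 'm) module \<Rightarrow> 'm set \<Rightarrow> (complex, 'm) module"
  where "generated_alg A S = A\<lparr>carrier := \<Inter>{B. unital_subalgebra B A \<and> S \<subseteq> B}\<rparr>"

section \<open>The algebras attached to a graph and a base vertex\<close>

definition adj_mat :: "'a set set \<Rightarrow> 'a \<Rightarrow> 'a \<Rightarrow> complex"
  where "adj_mat E = (\<lambda>x y. if {x, y} \<in> E then 1 else 0)"

definition diag_proj :: "'a set \<Rightarrow> 'a \<Rightarrow> 'a \<Rightarrow> complex"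
  where "diag_proj Y = (\<lambda>x y. if x = y \<and> x \<in> Y then 1 else 0)"

definition T1 :: "'a set \<Rightarrow> 'a set set \<Rightarrow> 'a \<Rightarrow> (complex, 'a \<Rightarrow> 'a \<Rightarrow> complex) module"
  where "T1 X E x0 = generated_alg (mat_alg X) {adj_mat E, diag_proj {x0}}"

definition T2 :: "'a set \<Rightarrow> 'a set set \<Rightarrow> 'a \<Rightarrow> (complex, 'a \<Rightarrow> 'a \<Rightarrow> complex) module"
  where "T2 X E x0 = generated_alg (mat_alg X)
    (insert (adj_mat E) ((\<lambda>k. diag_proj (sphere_at X E x0 k)) ` {0..eccentricity X E x0}))"

definition T3 :: "'a set \<Rightarrow> 'a set set \<Rightarrow> 'a \<Rightarrow> (complex, 'a \<Rightarrow> 'a \<Rightarrow> complex) module"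
  where "T3 X E x0 = generated_alg (mat_alg X)
    (insert (adj_mat E) (diag_proj ` orbits (vertex_stabilizer X E x0) X (\<lambda>\<sigma>. \<sigma>)))"

definition T4 :: "'a set \<Rightarrow> 'a set set \<Rightarrow> 'a \<Rightarrow> (complex, 'a \<Rightarrow> 'a \<Rightarrow> complex) module"
  where "T4 X E x0 = (mat_alg X)
    \<lparr>carrier := {M \<in> carrier (mat_alg X).
       \<forall>x\<in>X. \<forall>y\<in>X. \<forall>\<sigma> \<in> carrier (vertex_stabilizer X E x0). M (\<sigma> x) (\<sigma> y) = M x y}\<rparr>"

section \<open>Star graphs\<close>

definition star_vertices :: "nat \<Rightarrow> nat set"
  where "star_vertices n = {1..n}"

definition star_edges :: "nat \<Rightarrow> nat set set"
  where "star_edges n = {{1, i} | i. i \<in> {2..n}}"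

section \<open>Consistency of the encoding\<close>

lemma star_finite_connected_simple_graph:
  assumes "n \<ge> 1"
  shows "finite_connected_simple_graph (star_vertices n) (star_edges n)"
proof -
  have "e \<subseteq> star_vertices n \<and> card e = 2" if "e \<in> star_edges n" for e
    using that by (auto simp: star_edges_def star_vertices_def)
  moreover have to: "(x, 1) \<in> (adj_rel (star_edges n))\<^sup>*" and from_c: "(1, x) \<in> (adj_rel (star_edges n))\<^sup>*"
    if "x \<in> star_vertices n" for x
  proof -
    have "x = 1 \<or> {1, x} \<in> star_edges n"
      using that by (cases "x = 1") (auto simp: star_edges_def star_vertices_def)
    then show "(x, 1) \<in> (adj_rel (star_edges n))\<^sup>*" "(1, x) \<in> (adj_rel (star_edges n))\<^sup>*"
      by (auto simp: adj_rel_def insert_commute)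
  qed
  moreover have "finite (star_vertices n)" "star_vertices n \<noteq> {}"
    using assms by (auto simp: star_vertices_def)
  ultimately show ?thesis
    unfolding finite_connected_simple_graph_def by (meson rtrancl_trans)
qed

lemma mat_alg_ring:
  assumes "finite X"
  shows "ring (mat_alg X)"
proof (rule ringI)
  show "abelian_group (mat_alg X)"
  proof (rule abelian_groupI)
    fix M assume "M \<in> carrier (mat_alg X)"
    then show "\<exists>N\<in>carrier (mat_alg X). N \<oplus>\<^bsub>mat_alg X\<^esub> M = \<zero>\<^bsub>mat_alg X\<^esub>"
      by (intro bexI[of _ "\<lambda>x y. - M x y"]) (auto simp: mat_alg_def)
  qed (auto simp: mat_alg_def fun_eq_iff)
  show "monoid (mat_alg X)"
  proof (rule monoidI)
    fix L M N
    show "L \<otimes>\<^bsub>mat_alg X\<^esub> M \<otimes>\<^bsub>mat_alg X\<^esub> N = L \<otimes>\<^bsub>mat_alg X\<^esub> (M \<otimes>\<^bsub>mat_alg X\<^esub> N)"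
      unfolding mat_alg_def
      by (auto simp: fun_eq_iff sum_distrib_left sum_distrib_right mult.assoc intro: sum.swap)
  next
    fix M assume "M \<in> carrier (mat_alg X)"
    then have M: "\<And>x y. x \<notin> X \<or> y \<notin> X \<Longrightarrow> M x y = 0"
      by (auto simp: mat_alg_def)
    have "(\<Sum>z\<in>X. (if x \<in> X \<and> x = z then 1 else 0) * M z y) = M x y" for x y
    proof (cases "x \<in> X")
      case True
      then have "(\<Sum>z\<in>X. (if x \<in> X \<and> x = z then 1 else 0) * M z y) = (\<Sum>z\<in>X. if x = z then M z y else 0)"
        by (intro sum.cong) auto
      then show ?thesis
        using True assms by simp
    qed (simp add: M)
    then show "\<one>\<^bsub>mat_alg X\<^esub> \<otimes>\<^bsub>mat_alg X\<^esub> M = M"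
      by (simp add: mat_alg_def)
    have "(\<Sum>z\<in>X. M x z * (if z \<in> X \<and> z = y then 1 else 0)) = M x y" for x y
    proof -
      have "(\<Sum>z\<in>X. M x z * (if z \<in> X \<and> z = y then 1 else 0)) = (\<Sum>z\<in>X. if z = y then M x z else 0)"
        by (intro sum.cong) auto
      then show ?thesis
        using assms M by simp
    qed
    then show "M \<otimes>\<^bsub>mat_alg X\<^esub> \<one>\<^bsub>mat_alg X\<^esub> = M"
      by (simp add: mat_alg_def)
  qed (auto simp: mat_alg_def)
qed (auto simp: mat_alg_def fun_eq_iff sum.distrib algebra_simps)

lemma vertex_stabilizer_carrier:
  "carrier (vertex_stabilizer X E x0) =
    {\<sigma> \<in> Bij X. (\<forall>x\<in>X. \<forall>y\<in>X. {\<sigma> x, \<sigma> y} \<in> E \<longleftrightarrow> {x, y} \<in> E) \<and> \<sigma> x0 = x0}"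
  by (auto simp: vertex_stabilizer_def aut_group_def stabilizer_def)

lemma alg_dirsum_simps:
  "carrier (A \<oplus>\<^sub>\<C> B) = carrier A \<times> carrier B"
  "(a, b) \<otimes>\<^bsub>A \<oplus>\<^sub>\<C> B\<^esub> (a', b') = (a \<otimes>\<^bsub>A\<^esub> a', b \<otimes>\<^bsub>B\<^esub> b')"
  "\<one>\<^bsub>A \<oplus>\<^sub>\<C> B\<^esub> = (\<one>\<^bsub>A\<^esub>, \<one>\<^bsub>B\<^esub>)"
  "\<zero>\<^bsub>A \<oplus>\<^sub>\<C> B\<^esub> = (\<zero>\<^bsub>A\<^esub>, \<zero>\<^bsub>B\<^esub>)"
  "(a, b) \<oplus>\<^bsub>A \<oplus>\<^sub>\<C> B\<^esub> (a', b') = (a \<oplus>\<^bsub>A\<^esub> a', b \<oplus>\<^bsub>B\<^esub> b')"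
  "c \<odot>\<^bsub>A \<oplus>\<^sub>\<C> B\<^esub> (a, b) = (c \<odot>\<^bsub>A\<^esub> a, c \<odot>\<^bsub>B\<^esub> b)"
  by (auto simp: alg_dirsum_def RDirProd_def DirProd_def ring.defs monoid.defs module.defs)

end

theory Submission
  imports Defs
begin

text \<open>For every finite connected graph \<open>T1 \<subseteq> T2 \<subseteq> T4\<close> and \<open>T1 \<subseteq> T3 \<subseteq> T4\<close>. For the star with base vertex \<open>2\<close>, the
  stabilizer permutes the remaining leaves \<open>3, \<dots>, n\<close> arbitrarily, so a matrix in \<open>T4\<close> is constant on
  the blocks of the partition \<open>{1}, {2}, {3..n}\<close>, up to a multiple of the identity on \<open>{3..n}\<close>.
  All block indicators are already polynomials in \<open>A\<close> and \<open>E\<^sub>2\<close>, so the four algebras coincide.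
  Averaging over blocks splits off \<open>M\<^sub>3(\<complex>)\<close>; the remaining summand \<open>\<complex>\<close> is spanned by the projection
  onto the vectors supported on \<open>{3..n}\<close> with zero sum.\<close>

section \<open>Subalgebras of the matrix algebra\<close>

lemma mat_alg_simps [simp]:
  "carrier (mat_alg X) = {M. \<forall>x y. x \<notin> X \<or> y \<notin> X \<longrightarrow> M x y = 0}"
  "monoid.mult (mat_alg X) = (\<lambda>M N x y. \<Sum>z\<in>X. M x z * N z y)"
  "one (mat_alg X) = (\<lambda>x y. if x \<in> X \<and> x = y then 1 else 0)"
  "ring.zero (mat_alg X) = (\<lambda>x y. 0)"
  "add (mat_alg X) = (\<lambda>M N x y. M x y + N x y)"
  "smult (mat_alg X) = (\<lambda>c M x y. c * M x y)"
  by (simp_all add: mat_alg_def)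

lemma complex_alg_simps [simp]:
  "carrier complex_alg = UNIV" "monoid.mult complex_alg = (*)" "one complex_alg = 1"
  "ring.zero complex_alg = 0" "add complex_alg = (+)" "smult complex_alg = (*)"
  by (simp_all add: complex_alg_def)

text \<open>The additive inverse of a ring is only specified abstractly; its entrywise form is
  needed to check that \<open>T4\<close> is a subring.\<close>

lemma mat_alg_a_inv:
  assumes "finite X" "M \<in> carrier (mat_alg X)"
  shows "\<ominus>\<^bsub>mat_alg X\<^esub> M = (\<lambda>x y. - M x y)"
proof -
  interpret ring "mat_alg X" using assms(1) by (rule mat_alg_ring)
  have "(\<lambda>x y. - M x y) \<oplus>\<^bsub>mat_alg X\<^esub> M = \<zero>\<^bsub>mat_alg X\<^esub>" by simp
  then show ?thesis
    using assms(2) by (intro minus_equality) auto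
qed

lemma unital_subalgebra_matD:
  assumes "unital_subalgebra B (mat_alg X)"
  shows "(\<lambda>x y. if x \<in> X \<and> x = y then 1 else 0) \<in> B"
    and "M \<in> B \<Longrightarrow> N \<in> B \<Longrightarrow> (\<lambda>x y. \<Sum>z\<in>X. M x z * N z y) \<in> B"
    and "M \<in> B \<Longrightarrow> N \<in> B \<Longrightarrow> (\<lambda>x y. M x y + N x y) \<in> B"
    and "M \<in> B \<Longrightarrow> (\<lambda>x y. c * M x y) \<in> B"
    and "M \<in> B \<Longrightarrow> N \<in> B \<Longrightarrow> (\<lambda>x y. M x y - N x y) \<in> B"
proof -
  have sub: "subring B (mat_alg X)"
    and sm: "\<And>c M. M \<in> B \<Longrightarrow> (\<lambda>x y. c * M x y) \<in> B"
    using assms by (auto simp: unital_subalgebra_def)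
  show "(\<lambda>x y. if x \<in> X \<and> x = y then 1 else 0) \<in> B"
    using subringE(3)[OF sub] by simp
  show "M \<in> B \<Longrightarrow> N \<in> B \<Longrightarrow> (\<lambda>x y. \<Sum>z\<in>X. M x z * N z y) \<in> B"
    using subringE(6)[OF sub, of M N] by simp
  show add: "M \<in> B \<Longrightarrow> N \<in> B \<Longrightarrow> (\<lambda>x y. M x y + N x y) \<in> B" for M N
    using subringE(7)[OF sub, of M N] by simp
  show "M \<in> B \<Longrightarrow> (\<lambda>x y. c * M x y) \<in> B"
    by (rule sm)
  show "M \<in> B \<Longrightarrow> N \<in> B \<Longrightarrow> (\<lambda>x y. M x y - N x y) \<in> B"
    using add[of M "\<lambda>x y. (-1) * N x y"] sm[of N "-1"] by simp
qed

lemma generated_alg_mono: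
  "S \<subseteq> S' \<Longrightarrow> carrier (generated_alg A S) \<subseteq> carrier (generated_alg A S')"
  by (auto simp: generated_alg_def)

lemma generated_alg_least:
  "unital_subalgebra B A \<Longrightarrow> S \<subseteq> B \<Longrightarrow> carrier (generated_alg A S) \<subseteq> B"
  by (auto simp: generated_alg_def)

text \<open>The explicit map below runs from the model algebra \<open>B\<close> to \<open>A\<close>,
  while \<open>alg_iso\<close> asks for a map out of \<open>A\<close>. Closure of \<open>B\<close>
  lets the inverse be evaluated on sums, products and scalar multiples of images.\<close>

lemma alg_isoI_inv:
  assumes hom: "f \<in> ring_hom B A" and bij: "bij_betw f (carrier B) (carrier A)"
    and smult: "\<And>c b. b \<in> carrier B \<Longrightarrow> f (c \<odot>\<^bsub>B\<^esub> b) = c \<odot>\<^bsub>A\<^esub> f b"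
    and closed: "\<And>a b. a \<in> carrier B \<Longrightarrow> b \<in> carrier B \<Longrightarrow> a \<otimes>\<^bsub>B\<^esub> b \<in> carrier B"
      "\<And>a b. a \<in> carrier B \<Longrightarrow> b \<in> carrier B \<Longrightarrow> a \<oplus>\<^bsub>B\<^esub> b \<in> carrier B"
      "\<And>c b. b \<in> carrier B \<Longrightarrow> c \<odot>\<^bsub>B\<^esub> b \<in> carrier B" "\<one>\<^bsub>B\<^esub> \<in> carrier B"
  shows "A \<cong>\<^sub>\<C> B"
proof -
  define g where "g = inv_into (carrier B) f"
  have gf: "g (f b) = b" if "b \<in> carrier B" for b
    using bij_betw_inv_into_left[OF bij that] by (simp add: g_def)
  have im: "carrier A = f ` carrier B"
    using bij by (simp add: bij_betw_def)
  have "g \<in> ring_hom A B"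
  proof (rule ring_hom_memI)
    show "g \<one>\<^bsub>A\<^esub> = \<one>\<^bsub>B\<^esub>"
      using gf[OF closed(4)] ring_hom_one[OF hom] by simp
  qed (auto simp: im gf closed ring_hom_mult[OF hom, symmetric] ring_hom_add[OF hom, symmetric])
  moreover have "bij_betw g (carrier A) (carrier B)"
    unfolding g_def using bij by (rule bij_betw_inv_into)
  moreover have "g (c \<odot>\<^bsub>A\<^esub> a) = c \<odot>\<^bsub>B\<^esub> g a" if "a \<in> carrier A" for c a
    using that by (auto simp: im gf closed smult[symmetric])
  ultimately show ?thesis
    unfolding alg_iso_def ring_iso_def by blast
qed

section \<open>Inclusions between the four algebras\<close>

text \<open>\<open>T4\<close> is the commutant of the permutation matrices of the stabilizer. For
  products, the summation index is renamed along the bijection.\<close>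

lemma unital_subalgebra_T4:
  assumes "finite X"
  shows "unital_subalgebra (carrier (T4 X E x0)) (mat_alg X)"
proof -
  interpret ring "mat_alg X" using assms by (rule mat_alg_ring)
  let ?G = "carrier (vertex_stabilizer X E x0)"
  have bij: "bij_betw \<sigma> X X" if "\<sigma> \<in> ?G" for \<sigma>
    using that by (simp add: vertex_stabilizer_carrier Bij_def)
  have inj: "\<sigma> x = \<sigma> y \<longleftrightarrow> x = y" "\<sigma> x \<in> X" if "\<sigma> \<in> ?G" "x \<in> X" "y \<in> X" for \<sigma> x y
    using bij[OF that(1)] that by (auto simp: bij_betw_def inj_on_def)
  have reindex: "(\<Sum>z\<in>X. M (\<sigma> x) z * N z (\<sigma> y)) = (\<Sum>z\<in>X. M (\<sigma> x) (\<sigma> z) * N (\<sigma> z) (\<sigma> y))"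
    if "\<sigma> \<in> ?G" for \<sigma> and M N :: "'a \<Rightarrow> 'a \<Rightarrow> complex" and x y
    by (rule sum.reindex_bij_betw[OF bij[OF that], symmetric])
  have "subring (carrier (T4 X E x0)) (mat_alg X)"
  proof (rule subringI)
    fix M assume M: "M \<in> carrier (T4 X E x0)"
    then have "\<ominus>\<^bsub>mat_alg X\<^esub> M = (\<lambda>x y. - M x y)"
      using assms by (intro mat_alg_a_inv) (auto simp: T4_def)
    then show "\<ominus>\<^bsub>mat_alg X\<^esub> M \<in> carrier (T4 X E x0)"
      using M by (auto simp: T4_def)
  qed (auto simp: T4_def inj reindex)
  then show ?thesis
    by (auto simp: unital_subalgebra_def T4_def)
qed

text \<open>Injectivity preserves the zeros off the diagonal, invariance of \<open>Y\<close> the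
  diagonal. This serves both the spheres of \<open>T2\<close> and the orbits of
  \<open>T3\<close>.\<close>

lemma diag_proj_mem_T4:
  assumes "Y \<subseteq> X" and inv: "\<And>\<sigma> x. \<sigma> \<in> carrier (vertex_stabilizer X E x0) \<Longrightarrow> x \<in> X \<Longrightarrow> \<sigma> x \<in> Y \<longleftrightarrow> x \<in> Y"
  shows "diag_proj Y \<in> carrier (T4 X E x0)"
proof -
  have "\<sigma> x = \<sigma> y \<longleftrightarrow> x = y" if "\<sigma> \<in> carrier (vertex_stabilizer X E x0)" "x \<in> X" "y \<in> X" for \<sigma> x y
    using that by (auto simp: vertex_stabilizer_carrier Bij_def bij_betw_def inj_on_def)
  with assms show ?thesis
    by (auto simp: T4_def diag_proj_def)
qed

lemma adj_mat_mem_T4: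
  assumes "\<And>e. e \<in> E \<Longrightarrow> e \<subseteq> X"
  shows "adj_mat E \<in> carrier (T4 X E x0)"
  using assms by (force simp: T4_def adj_mat_def vertex_stabilizer_carrier)

text \<open>Invariance for every walk length gives invariance of \<open>graph_dist\<close>, which is
  the least such length. The induction cuts off the last edge and pulls the intermediate vertex back
  through the surjection.\<close>

lemma walk_automorphism_iff:
  assumes E: "\<And>e. e \<in> E \<Longrightarrow> e \<subseteq> X" and \<sigma>: "\<sigma> \<in> carrier (vertex_stabilizer X E x0)"
    and "x \<in> X" "y \<in> X"
  shows "(\<sigma> x, \<sigma> y) \<in> adj_rel E ^^ k \<longleftrightarrow> (x, y) \<in> adj_rel E ^^ k"
  using \<open>y \<in> X\<close>
proof (induction k arbitrary: y)
  case 0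
  then show ?case
    using \<sigma> \<open>x \<in> X\<close> by (auto simp: vertex_stabilizer_carrier Bij_def bij_betw_def inj_on_def)
next
  case (Suc k)
  have img: "\<sigma> ` X = X"
    and edge: "(\<sigma> u, \<sigma> v) \<in> adj_rel E \<longleftrightarrow> (u, v) \<in> adj_rel E" if "u \<in> X" "v \<in> X" for u v
    using \<sigma> that by (auto simp: vertex_stabilizer_carrier Bij_def bij_betw_def adj_rel_def)
  have X: "u \<in> X" if "(u, v) \<in> adj_rel E" for u v
    using E that by (auto simp: adj_rel_def)
  have "(\<sigma> x, \<sigma> y) \<in> adj_rel E ^^ Suc k
      \<longleftrightarrow> (\<exists>w\<in>\<sigma> ` X. (\<sigma> x, w) \<in> adj_rel E ^^ k \<and> (w, \<sigma> y) \<in> adj_rel E)"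
    using X img[OF Suc.prems Suc.prems] by auto
  also have "\<dots> \<longleftrightarrow> (\<exists>z\<in>X. (x, z) \<in> adj_rel E ^^ k \<and> (z, y) \<in> adj_rel E)"
    using Suc edge by auto
  also have "\<dots> \<longleftrightarrow> (x, y) \<in> adj_rel E ^^ Suc k"
    using X by auto
  finally show ?case .
qed

text \<open>This exhibits the generator \<open>diag_proj {x0}\<close> of \<open>T1\<close> among
  those of \<open>T2\<close>.\<close>

lemma sphere_at_0:
  assumes "finite_connected_simple_graph X E" "x0 \<in> X"
  shows "sphere_at X E x0 0 = {x0}"
proof -
  have "graph_dist E x0 x = 0 \<longleftrightarrow> x = x0" if "x \<in> X" for x
  proof
    assume 0: "graph_dist E x0 x = 0"
    have "(x0, x) \<in> (adj_rel E)\<^sup>*"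
      using assms that by (auto simp: finite_connected_simple_graph_def)
    then obtain k where "(x0, x) \<in> adj_rel E ^^ k"
      by (auto simp: rtrancl_power)
    \<comment> \<open>Connectedness provides some walk, so the least length is attained and distance
      0 really means a walk of length 0.\<close>
    then have "(x0, x) \<in> adj_rel E ^^ graph_dist E x0 x"
      unfolding graph_dist_def by (rule LeastI)
    with 0 show "x = x0" by simp
  next
    assume "x = x0"
    then show "graph_dist E x0 x = 0"
      unfolding graph_dist_def by (intro Least_eq_0) simp
  qed
  with assms(2) show ?thesis
    by (auto simp: sphere_at_def)
qed

lemma T1_subset_T2:
  assumes "finite_connected_simple_graph X E" "x0 \<in> X"
  shows "carrier (T1 X E x0) \<subseteq> carrier (T2 X E x0)"
  unfolding T1_def T2_def using sphere_at_0[OF assms]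
  by (intro generated_alg_mono) (auto intro!: image_eqI[where x = 0])

lemma T1_subset_T3:
  assumes "x0 \<in> X"
  shows "carrier (T1 X E x0) \<subseteq> carrier (T3 X E x0)"
proof -
  let ?H = "vertex_stabilizer X E x0"
  \<comment> \<open>Stabilizer elements all fix \<open>x0\<close>; the identity shows that the orbit
    is nonempty. It is restricted because elements of \<open>Bij X\<close> are
    \<open>undefined\<close> outside \<open>X\<close>.\<close>
  have "(\<lambda>x\<in>X. x) \<in> carrier ?H"
    using assms by (auto simp: vertex_stabilizer_carrier id_Bij)
  then have "orbit ?H (\<lambda>\<sigma>. \<sigma>) x0 = {x0}"
    using assms by (auto simp: orbit_def vertex_stabilizer_carrier intro!: exI[of _ "\<lambda>x\<in>X. x"])
  then have "{x0} \<in> orbits ?H X (\<lambda>\<sigma>. \<sigma>)"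
    using assms by (auto simp: orbits_def)
  then show ?thesis
    unfolding T1_def T3_def by (intro generated_alg_mono) auto
qed

text \<open>The stabilizer preserves the distance to \<open>x0\<close>, so every sphere is
  invariant.\<close>

lemma T2_subset_T4:
  assumes "finite_connected_simple_graph X E" "x0 \<in> X"
  shows "carrier (T2 X E x0) \<subseteq> carrier (T4 X E x0)"
proof -
  have fin: "finite X" and E: "\<And>e. e \<in> E \<Longrightarrow> e \<subseteq> X"
    using assms by (auto simp: finite_connected_simple_graph_def)
  have "diag_proj (sphere_at X E x0 k) \<in> carrier (T4 X E x0)" for k
  proof (rule diag_proj_mem_T4)
    fix \<sigma> x assume \<sigma>: "\<sigma> \<in> carrier (vertex_stabilizer X E x0)" and x: "x \<in> X"
    then have "\<sigma> x0 = x0" "\<sigma> x \<in> X"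
      by (auto simp: vertex_stabilizer_carrier Bij_def bij_betw_def)
    then have "graph_dist E x0 (\<sigma> x) = graph_dist E x0 x"
      using walk_automorphism_iff[OF E \<sigma> assms(2) x] by (simp add: graph_dist_def)
    with \<open>\<sigma> x \<in> X\<close> x show "\<sigma> x \<in> sphere_at X E x0 k \<longleftrightarrow> x \<in> sphere_at X E x0 k"
      by (simp add: sphere_at_def)
  qed (auto simp: sphere_at_def)
  then show ?thesis
    unfolding T2_def using adj_mat_mem_T4[OF E]
    by (intro generated_alg_least unital_subalgebra_T4 fin) auto
qed

text \<open>Orbits are invariant: composition shows that the stabilizer maps an orbit into itself,
  and inverses give the converse implication.\<close>

lemma T3_subset_T4:
  assumes "finite_connected_simple_graph X E" "x0 \<in> X"
  shows "carrier (T3 X E x0) \<subseteq> carrier (T4 X E x0)"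
proof -
  let ?H = "vertex_stabilizer X E x0"
  have fin: "finite X" and E: "\<And>e. e \<in> E \<Longrightarrow> e \<subseteq> X"
    using assms by (auto simp: finite_connected_simple_graph_def)
  have stab: "\<sigma> \<in> carrier ?H \<longleftrightarrow> \<sigma> \<in> Bij X \<and>
      (\<forall>x\<in>X. \<forall>y\<in>X. {\<sigma> x, \<sigma> y} \<in> E \<longleftrightarrow> {x, y} \<in> E) \<and> \<sigma> x0 = x0" for \<sigma>
    by (auto simp: vertex_stabilizer_carrier)
  have maps: "\<sigma> x \<in> X" if "\<sigma> \<in> carrier ?H" "x \<in> X" for \<sigma> x
    using that by (auto simp: stab Bij_def bij_betw_def)
  have comp: "compose X \<sigma> \<tau> \<in> carrier ?H" if "\<sigma> \<in> carrier ?H" "\<tau> \<in> carrier ?H" for \<sigma> \<tau>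
    using that maps[OF that(2)] assms(2) compose_Bij[of \<sigma> X \<tau>]
    by (auto simp: stab compose_def)
  have inv: "\<exists>\<tau>\<in>carrier ?H. \<forall>x\<in>X. \<tau> (\<sigma> x) = x" if "\<sigma> \<in> carrier ?H" for \<sigma>
  proof
    let ?\<tau> = "\<lambda>x\<in>X. inv_into X \<sigma> x"
    have bij: "bij_betw \<sigma> X X"
      using that by (simp add: stab Bij_def)
    have left: "?\<tau> (\<sigma> x) = x" if "x \<in> X" for x
      using bij_betw_inv_into_left[OF bij that] maps[OF \<open>\<sigma> \<in> carrier ?H\<close> that] by simp
    have "{?\<tau> x, ?\<tau> y} \<in> E \<longleftrightarrow> {x, y} \<in> E" if "x \<in> X" "y \<in> X" for x y
    proof -
      obtain u v where uv: "u \<in> X" "v \<in> X" "x = \<sigma> u" "y = \<sigma> v"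
        using \<open>x \<in> X\<close> \<open>y \<in> X\<close> bij_betw_imp_surj_on[OF bij] by (metis imageE)
      then have "{\<sigma> u, \<sigma> v} \<in> E \<longleftrightarrow> {u, v} \<in> E"
        using \<open>\<sigma> \<in> carrier ?H\<close> by (simp add: stab)
      then show ?thesis
        using left[OF uv(1)] left[OF uv(2)] uv(3,4) by simp
    qed
    moreover have "\<sigma> x0 = x0"
      using that by (simp add: stab)
    then have "?\<tau> x0 = x0"
      using left[OF assms(2)] by (simp only:)
    ultimately show "?\<tau> \<in> carrier ?H"
      using that restrict_inv_into_Bij[of \<sigma> X] by (auto simp: stab)
    show "\<forall>x\<in>X. ?\<tau> (\<sigma> x) = x"
      using left by blast
  qed
  have "diag_proj Y \<in> carrier (T4 X E x0)" if Y: "Y \<in> orbits ?H X (\<lambda>\<sigma>. \<sigma>)" for Y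
  proof (rule diag_proj_mem_T4)
    obtain u where u: "u \<in> X" "Y = {\<tau> u | \<tau>. \<tau> \<in> carrier ?H}"
      using Y by (auto simp: orbits_def orbit_def)
    then show "Y \<subseteq> X"
      using maps by auto
    fix \<sigma> x assume \<sigma>: "\<sigma> \<in> carrier ?H" and x: "x \<in> X"
    have closed: "\<rho> y \<in> Y" if \<rho>: "\<rho> \<in> carrier ?H" and y: "y \<in> Y" for \<rho> y
    proof -
      obtain \<tau> where \<tau>: "\<tau> \<in> carrier ?H" "y = \<tau> u"
        using y u(2) by blast
      then have "\<rho> y = compose X \<rho> \<tau> u"
        using u(1) by (simp add: compose_def)
      with comp[OF \<rho> \<tau>(1)] show ?thesis
        using u(2) by blast
    qed
    \<comment> \<open>If \<open>\<sigma> x\<close> lies in \<open>Y\<close>, applying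
      \<open>\<rho>\<close> brings \<open>x\<close> back into \<open>Y\<close>.\<close>
    obtain \<rho> where "\<rho> \<in> carrier ?H" "\<rho> (\<sigma> x) = x"
      using inv[OF \<sigma>] x by blast
    with closed \<sigma> show "\<sigma> x \<in> Y \<longleftrightarrow> x \<in> Y"
      by metis
  qed
  then show ?thesis
    unfolding T3_def using adj_mat_mem_T4[OF E]
    by (intro generated_alg_least unital_subalgebra_T4 fin) auto
qed

section \<open>The star with a leaf as base vertex\<close>

lemma star_edge_iff:
  "{x, y} \<in> star_edges n \<longleftrightarrow> x = 1 \<and> y \<in> {2..n} \<or> y = 1 \<and> x \<in> {2..n}"
  by (auto simp: star_edges_def doubleton_eq_iff)

text \<open>Adjacency in a star depends only on which vertex is the centre, so transposing two
  leaves other than 2 is an automorphism fixing 2. The case \<open>a = b\<close> gives the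
  identity.\<close>

lemma leaf_swap_mem_stabilizer:
  assumes "a \<in> {3..n}" "b \<in> {3..n}"
  shows "(\<lambda>z\<in>{1..n}. if z = a then b else if z = b then a else z)
    \<in> carrier (vertex_stabilizer {1..n} (star_edges n) 2)" (is "?\<sigma> \<in> _")
proof -
  have "bij_betw ?\<sigma> {1..n} {1..n}"
    by (rule bij_betw_byWitness[where f' = ?\<sigma>]) (use assms in auto)
  then have "?\<sigma> \<in> Bij {1..n}"
    by (simp add: Bij_def)
  moreover have "{?\<sigma> x, ?\<sigma> y} \<in> star_edges n \<longleftrightarrow> {x, y} \<in> star_edges n"
    if "x \<in> {1..n}" "y \<in> {1..n}" for x y
    using that assms unfolding star_edge_iff by auto
  ultimately show ?thesis
    using assms by (auto simp: vertex_stabilizer_carrier)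
qed

text \<open>Row \<open>x\<close> belongs to block \<open>min x 3\<close>. The weight \<open>1 / (n - 2)\<close> on the columns of the large block makes the
  map multiplicative; the factor of \<open>d\<close> is the projection onto the zero-sum vectors on \<open>{3..n}\<close>.\<close>

definition star_embed :: "nat \<Rightarrow> (nat \<Rightarrow> nat \<Rightarrow> complex) \<times> complex \<Rightarrow> nat \<Rightarrow> nat \<Rightarrow> complex"
  where "star_embed n = (\<lambda>(N, d) x y. if x \<in> {1..n} \<and> y \<in> {1..n}
    then N (min x 3) (min y 3) * (if y \<ge> 3 then 1 / (of_nat n - 2) else 1)
      + (if x \<ge> 3 \<and> y \<ge> 3 then d * ((if x = y then 1 else 0) - 1 / (of_nat n - 2)) else 0)
    else 0)"

lemma star_embed_outside:
  assumes "x \<notin> {1..n} \<or> y \<notin> {1..n}"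
  shows "star_embed n p x y = 0"
proof -
  have "\<not> (x \<in> {1..n} \<and> y \<in> {1..n})"
    using assms by blast
  then show ?thesis
    by (cases p) (simp only: star_embed_def prod.case if_False)
qed

section \<open>Multiplicativity of the embedding\<close>

lemma sum_star:
  fixes f :: "nat \<Rightarrow> complex"
  assumes "n \<ge> 2"
  shows "(\<Sum>z = 1..n. f z) = f 1 + f 2 + (\<Sum>z = 3..n. f z)"
proof -
  have "{1..n} = insert 1 (insert 2 {3..n})"
    using assms by auto
  then show ?thesis
    by (simp add: add.assoc)
qed

lemma sum_3: "(\<Sum>z = 1..3. f z) = f 1 + f 2 + f 3" for f :: "nat \<Rightarrow> complex"
  using sum_star[of 3 f] by simp

lemma leaf_weight_nonzero:
  assumes "n \<ge> 3"
  shows "of_nat n - 2 \<noteq> (0 :: complex)"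
proof -
  have "of_nat (n - 2) \<noteq> (0 :: complex)"
    using assms by (subst of_nat_eq_0_iff) simp
  then show ?thesis
    using assms by (simp add: of_nat_diff)
qed

text \<open>Here \<open>q\<close> is the kernel of the projection onto zero-sum vectors on the
  \<open>m\<close> leaves \<open>{3..n}\<close>. Its row and column sums vanish, which kills the
  cross terms, and it is idempotent. If \<open>x\<close> or \<open>y\<close> is not one of these
  leaves, the zero coefficient switches its term off.\<close>

lemma sum_zero_sum_proj:
  fixes a b c d m :: complex
  assumes m: "m = of_nat n - 2" "n \<ge> 3" and x: "c = 0 \<or> x \<in> {3..n}" and y: "d = 0 \<or> y \<in> {3..n}"
  defines "q \<equiv> \<lambda>u v. (if u = v then 1 else 0) - 1 / m"
  shows "(\<Sum>z = 3..n. (a + c * q x z) * (b + d * q z y)) = m * (a * b) + c * d * q x y"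
proof -
  have card: "of_nat (card {3..n}) = m"
    using m by (simp add: of_nat_diff)
  have "m \<noteq> 0"
    using leaf_weight_nonzero[OF m(2)] m(1) by simp
  have row: "(\<Sum>z = 3..n. c * q x z) = 0"
    using x \<open>m \<noteq> 0\<close> card by (auto simp: q_def sum_subtractf sum_distrib_left[symmetric])
  have col: "(\<Sum>z = 3..n. d * q z y) = 0"
    using y \<open>m \<noteq> 0\<close> card by (auto simp: q_def sum_subtractf sum_distrib_left[symmetric])
  have sq: "(\<Sum>z = 3..n. (c * q x z) * (d * q z y)) = c * d * q x y"
  proof (cases "c = 0")
    case False
    have "(\<Sum>z = 3..n. (c * q x z) * (d * q z y))
        = (\<Sum>z = 3..n. (if x = z then c * d * q z y else 0) - c / m * (d * q z y))"
      by (intro sum.cong refl) (simp add: q_def algebra_simps)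
    also have "\<dots> = c * d * q x y - c / m * (\<Sum>z = 3..n. d * q z y)"
      using x False by (simp add: sum_subtractf sum_distrib_left)
    finally show ?thesis
      by (simp add: col)
  qed simp
  have "(\<Sum>z = 3..n. (a + c * q x z) * (b + d * q z y))
      = (\<Sum>z = 3..n. a * b + a * (d * q z y) + b * (c * q x z) + (c * q x z) * (d * q z y))"
    by (intro sum.cong refl) (simp add: algebra_simps)
  also have "\<dots> = (\<Sum>z = 3..n. a * b) + a * (\<Sum>z = 3..n. d * q z y) + b * (\<Sum>z = 3..n. c * q x z)
      + (\<Sum>z = 3..n. (c * q x z) * (d * q z y))"
    by (simp only: sum.distrib sum_distrib_left)
  also have "\<dots> = m * (a * b) + c * d * q x y"
    unfolding row col sq using card by simp
  finally show ?thesis .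
qed

lemma star_embed_mult:
  assumes "n \<ge> 3"
  shows "star_embed n (\<lambda>i j. \<Sum>k = 1..3. N i k * N' k j, d * d') x y
    = (\<Sum>z = 1..n. star_embed n (N, d) x z * star_embed n (N', d') z y)"
proof (cases "x \<in> {1..n} \<and> y \<in> {1..n}")
  case True
  define m :: complex where "m = of_nat n - 2"
  have m0: "m \<noteq> 0"
    using leaf_weight_nonzero[of n] assms by (simp add: m_def)
  \<comment> \<open>On the large block, each factor splits into a part constant in \<open>z\<close>
    (\<open>a\<close>, \<open>b\<close>) and a multiple of the projection kernel (\<open>c\<close>,
    \<open>e\<close>).\<close>
  define a where "a = N (min x 3) 3 / m"
  define b where "b = N' 3 (min y 3) * (if y \<ge> 3 then 1 / m else 1)"
  define c where "c = (if x \<ge> 3 then d else 0)"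
  define e where "e = (if y \<ge> 3 then d' else 0)"
  have "(\<Sum>z = 3..n. star_embed n (N, d) x z * star_embed n (N', d') z y)
      = (\<Sum>z = 3..n. (a + c * ((if x = z then 1 else 0) - 1 / m))
          * (b + e * ((if z = y then 1 else 0) - 1 / m)))"
    using True by (intro sum.cong refl) (auto simp: star_embed_def a_def b_def c_def e_def m_def)
  also have "\<dots> = m * (a * b) + c * e * ((if x = y then 1 else 0) - 1 / m)"
    using True assms by (intro sum_zero_sum_proj) (auto simp: m_def c_def e_def)
  finally have leaves: "(\<Sum>z = 3..n. star_embed n (N, d) x z * star_embed n (N', d') z y)
    = m * (a * b) + c * e * ((if x = y then 1 else 0) - 1 / m)" .
  define v where "v = (if y \<ge> 3 then 1 / m else 1)"
  \<comment> \<open>The \<open>m\<close> equal terms of the sum cancel the weight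
    \<open>1 / m\<close> in \<open>a\<close>, leaving the \<open>k = 3\<close> term of the 3 by 3
    product.\<close>
  have "m * (a * b) = N (min x 3) 3 * N' 3 (min y 3) * v"
    using m0 by (simp add: a_def b_def v_def)
  moreover have "star_embed n (N, d) x k = N (min x 3) k" "star_embed n (N', d') k y = N' k (min y 3) * v"
    if "k \<in> {1, 2}" for k
    using True that assms by (auto simp: star_embed_def v_def m_def)
  ultimately have "(\<Sum>z = 1..n. star_embed n (N, d) x z * star_embed n (N', d') z y)
      = N (min x 3) 1 * (N' 1 (min y 3) * v) + N (min x 3) 2 * (N' 2 (min y 3) * v)
        + (N (min x 3) 3 * N' 3 (min y 3) * v + c * e * ((if x = y then 1 else 0) - 1 / m))"
    using assms leaves by (subst sum_star) simp_all
  also have "\<dots> = (\<Sum>k = 1..3. N (min x 3) k * N' k (min y 3)) * v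
      + c * e * ((if x = y then 1 else 0) - 1 / m)"
    by (subst sum_3) (simp add: algebra_simps)
  also have "\<dots> = star_embed n (\<lambda>i j. \<Sum>k = 1..3. N i k * N' k j, d * d') x y"
    using True by (simp add: star_embed_def c_def e_def v_def m_def)
  finally show ?thesis ..
next
  case False
  have "star_embed n (N, d) x z * star_embed n (N', d') z y = 0" for z
    using False star_embed_outside[of x n z] star_embed_outside[of z n y] by auto
  then have "(\<Sum>z = 1..n. star_embed n (N, d) x z * star_embed n (N', d') z y) = 0"
    by (intro sum.neutral ballI)
  with False show ?thesis
    using star_embed_outside[of x n y] by simp
qed

lemma star_embed_hom:
  assumes "n \<ge> 3"
  shows "star_embed n \<in> ring_hom (mat_alg {1..3::nat} \<oplus>\<^sub>\<C> complex_alg) (mat_alg {1..n})"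
proof (rule ring_hom_memI)
  \<comment> \<open>On the large block the weight contributed by the entry at \<open>(3, 3)\<close>
    cancels the one subtracted in the projection.\<close>
  show "star_embed n \<one>\<^bsub>mat_alg {1..3::nat} \<oplus>\<^sub>\<C> complex_alg\<^esub> = \<one>\<^bsub>mat_alg {1..n}\<^esub>"
    by (auto simp: alg_dirsum_simps star_embed_def fun_eq_iff min_def)
next
  fix p q assume "p \<in> carrier (mat_alg {1..3::nat} \<oplus>\<^sub>\<C> complex_alg)" "q \<in> carrier (mat_alg {1..3::nat} \<oplus>\<^sub>\<C> complex_alg)"
  show "star_embed n (p \<otimes>\<^bsub>mat_alg {1..3::nat} \<oplus>\<^sub>\<C> complex_alg\<^esub> q)
      = star_embed n p \<otimes>\<^bsub>mat_alg {1..n}\<^esub> star_embed n q"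
    by (cases p; cases q) (simp add: alg_dirsum_simps fun_eq_iff star_embed_mult[OF assms] del: One_nat_def)
  show "star_embed n (p \<oplus>\<^bsub>mat_alg {1..3::nat} \<oplus>\<^sub>\<C> complex_alg\<^esub> q)
      = star_embed n p \<oplus>\<^bsub>mat_alg {1..n}\<^esub> star_embed n q"
    by (cases p; cases q) (auto simp: alg_dirsum_simps fun_eq_iff star_embed_def algebra_simps add_divide_distrib)
qed (simp add: star_embed_outside)

section \<open>Injectivity of the embedding, and \<open>T4\<close> inside its image\<close>

lemma star_embed_inj:
  assumes "n \<ge> 4"
  shows "inj_on (star_embed n) (carrier (mat_alg {1..3::nat} \<oplus>\<^sub>\<C> complex_alg))"
proof (rule inj_onI)
  fix p q
  assume p: "p \<in> carrier (mat_alg {1..3::nat} \<oplus>\<^sub>\<C> complex_alg)"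
    and q: "q \<in> carrier (mat_alg {1..3::nat} \<oplus>\<^sub>\<C> complex_alg)"
    and eq: "star_embed n p = star_embed n q"
  obtain N d N' d' where pq: "p = (N, d)" "q = (N', d')"
    by (cases p; cases q)
  have m0: "of_nat n - 2 \<noteq> (0 :: complex)"
    using leaf_weight_nonzero[of n] assms by simp
  have at: "star_embed n (N, d) x y = star_embed n (N', d') x y" for x y
    using eq pq by simp
  \<comment> \<open>The entries at \<open>(3, 3)\<close> and \<open>(3, 4)\<close> differ by exactly
    \<open>d\<close>; the second leaf 4 exists because \<open>n \<ge> 4\<close>. Once
    \<open>d\<close> is known, the entries at block representatives determine
    \<open>N\<close>.\<close>
  have d: "d = d'"
    using at[of 3 3] at[of 3 4] assms by (simp add: star_embed_def algebra_simps)
  have inside: "N i j = N' i j" if "i \<in> {1..3}" "j \<in> {1..3}" for i j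
  proof -
    have "min i 3 = i" "min j 3 = j" "i \<in> {1..n}" "j \<in> {1..n}"
      using that assms by auto
    then show ?thesis
      using at[of i j] m0 by (simp add: star_embed_def d split: if_split_asm)
  qed
  have outside: "N i j = 0" "N' i j = 0" if "i \<notin> {1..3} \<or> j \<notin> {1..3}" for i j
    using p q that unfolding pq alg_dirsum_simps mat_alg_simps by blast+
  have "N = N'"
    using inside outside by (intro ext) metis
  with d pq show "p = q" by simp
qed

text \<open>Invariance under transpositions of \<open>{3..n}\<close> leaves free the entries on
  \<open>{1, 2}\<close>, one value per mixed row or column, and two values on the large block:
  diagonal and off-diagonal.\<close>

lemma T4_star_subset_range:
  assumes "n \<ge> 4"
  shows "carrier (T4 {1..n} (star_edges n) 2)
    \<subseteq> star_embed n ` carrier (mat_alg {1..3::nat} \<oplus>\<^sub>\<C> complex_alg)"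
proof
  fix M assume M: "M \<in> carrier (T4 {1..n} (star_edges n) 2)"
  define m :: complex where "m = of_nat n - 2"
  have m0: "m \<noteq> 0"
    using leaf_weight_nonzero[of n] assms by (simp add: m_def)
  have swap: "M (if x = a then b else if x = b then a else x) (if y = a then b else if y = b then a else y) = M x y"
    if "a \<in> {3..n}" "b \<in> {3..n}" "x \<in> {1..n}" "y \<in> {1..n}" for a b x y
  proof -
    have "M (\<sigma> x) (\<sigma> y) = M x y" if "\<sigma> \<in> carrier (vertex_stabilizer {1..n} (star_edges n) 2)" for \<sigma>
      using M that \<open>x \<in> {1..n}\<close> \<open>y \<in> {1..n}\<close> unfolding T4_def by simp
    from this[OF leaf_swap_mem_stabilizer[OF that(1,2)]] show ?thesis
      by (simp only: restrict_apply' that)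
  qed
  have col: "M x y = M 3 y" if "x \<in> {3..n}" "y \<in> {1, 2}" for x y
    using swap[of x 3 x y] that assms by auto
  have row: "M x y = M x 3" if "y \<in> {3..n}" "x \<in> {1, 2}" for x y
    using swap[of y 3 x y] that assms by auto
  have diag: "M x x = M 3 3" if "x \<in> {3..n}" for x
    using swap[of x 3 x x] that assms by auto
  have off: "M x y = M 3 4" if "x \<in> {3..n}" "y \<in> {3..n}" "x \<noteq> y" for x y
  proof -
    \<comment> \<open>The first swap moves \<open>x\<close> to 3 and, when \<open>y = 3\<close>,
      moves \<open>y\<close> to the old \<open>x\<close>; a second swap moves \<open>y'\<close> to
      4.\<close>
    define y' where "y' = (if y = 3 then x else y)"
    have "M x y = M 3 y'"
      using swap[of x 3 x y] that assms by (auto simp: y'_def)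
    also have "\<dots> = M 3 4"
      using swap[of y' 4 3 y'] that assms by (auto simp: y'_def split: if_splits)
    finally show ?thesis .
  qed
  \<comment> \<open>Solves \<open>N 3 3 / m + d * (1 - 1 / m) = M 3 3\<close> and
    \<open>N 3 3 / m - d / m = M 3 4\<close>. In the other entries of column 3, the factor
    \<open>m\<close> undoes the column weight.\<close>
  define d where "d = M 3 3 - M 3 4"
  define N where "N = (\<lambda>i j. if i \<in> {1..3} \<and> j \<in> {1..3}
    then if j = 3 then if i = 3 then m * M 3 4 + d else m * M i 3 else M i j else 0)"
  have "M x y = star_embed n (N, d) x y" for x y
  proof (cases "x \<in> {1..n} \<and> y \<in> {1..n}")
    case False
    have "M \<in> carrier (mat_alg {1..n})"
      using M unfolding T4_def by (simp del: mat_alg_simps)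
    then have "M x y = 0"
      using False by (simp only: mat_alg_simps mem_Collect_eq) blast
    with False show ?thesis
      using star_embed_outside[of x n y] by simp
  next
    case True
    have split: "z \<in> {1, 2} \<or> z \<in> {3..n}" if "z \<in> {1..n}" for z
      using that by (cases "z \<le> 2") auto
    with True have xy: "x \<in> {1, 2} \<or> x \<in> {3..n}" "y \<in> {1, 2} \<or> y \<in> {3..n}"
      by blast+
    consider "x \<in> {1, 2}" "y \<in> {1, 2}" | "x \<in> {3..n}" "y \<in> {1, 2}" | "x \<in> {1, 2}" "y \<in> {3..n}"
      | "x \<in> {3..n}" "y = x" | "x \<in> {3..n}" "y \<in> {3..n}" "x \<noteq> y"
      using xy by blast
    then show ?thesis
    proof cases
      case 1
      then show ?thesis using assms by (auto simp: star_embed_def N_def)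
    next
      case 2
      then show ?thesis using assms col[OF 2] by (auto simp: star_embed_def N_def)
    next
      case 3
      then show ?thesis using assms m0 row[OF 3(2,1)] by (auto simp: star_embed_def N_def m_def)
    next
      case 4
      then show ?thesis
        using m0 diag[OF 4(1)] by (auto simp: star_embed_def N_def m_def[symmetric] d_def field_simps)
    next
      case 5
      then show ?thesis
        using m0 off[OF 5] by (auto simp: star_embed_def N_def m_def[symmetric] d_def field_simps)
    qed
  qed
  then have "M = star_embed n (N, d)" by blast
  moreover have "(N, d) \<in> carrier (mat_alg {1..3::nat} \<oplus>\<^sub>\<C> complex_alg)"
    by (auto simp: alg_dirsum_simps N_def)
  ultimately show "M \<in> star_embed n ` carrier (mat_alg {1..3::nat} \<oplus>\<^sub>\<C> complex_alg)"
    by blast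
qed

section \<open>Generation of the image by \<open>A\<close> and \<open>E_2\<close>\<close>

definition star_block :: "nat \<Rightarrow> nat \<Rightarrow> nat \<Rightarrow> nat \<Rightarrow> nat \<Rightarrow> complex"
  where "star_block n i j x y = (if x \<in> {1..n} \<and> y \<in> {1..n} \<and> min x 3 = i \<and> min y 3 = j then 1 else 0)"

text \<open>Since 1 is the only neighbour of 2, multiplying \<open>A\<close> by the projection at 2
  isolates the blocks \<open>(1, 2)\<close> and \<open>(2, 1)\<close>, whose product is
  \<open>(1, 1)\<close>. The rest of row and column 1 comes from \<open>A\<close>, and every block
  \<open>(i, j)\<close> is the product of \<open>(i, 1)\<close> and \<open>(1, j)\<close>.\<close>

lemma star_block_mem_subalgebra:
  assumes n: "n \<ge> 4" and B: "unital_subalgebra B (mat_alg {1..n})"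
    and A: "adj_mat (star_edges n) \<in> B" and E2: "diag_proj {2} \<in> B"
    and ij: "i \<in> {1..3}" "j \<in> {1..3}"
  shows "star_block n i j \<in> B"
proof -
  note mult = unital_subalgebra_matD(2)[OF B] and diff = unital_subalgebra_matD(5)[OF B]
  let ?A = "adj_mat (star_edges n)"
  have sum: "(\<Sum>z = 1..n. f z) = f 1 + f 2 + (\<Sum>z = 3..n. f z)" for f :: "nat \<Rightarrow> complex"
    using n by (intro sum_star) simp
  have L0: "(\<Sum>z = 3..n. f z) = 0" if "\<And>z. z \<in> {3..n} \<Longrightarrow> f z = 0" for f :: "nat \<Rightarrow> complex"
    using that by (rule sum.neutral[rule_format])
  have "star_block n 1 2 = (\<lambda>x y. \<Sum>z = 1..n. ?A x z * diag_proj {2} z y)"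
    unfolding sum using n
    by (subst L0) (auto simp: star_block_def adj_mat_def star_edge_iff diag_proj_def fun_eq_iff min_def)
  then have b12: "star_block n 1 2 \<in> B"
    using mult[OF A E2] by simp
  have "star_block n 2 1 = (\<lambda>x y. \<Sum>z = 1..n. diag_proj {2} x z * ?A z y)"
    unfolding sum using n
    by (subst L0) (auto simp: star_block_def adj_mat_def star_edge_iff diag_proj_def fun_eq_iff min_def)
  then have b21: "star_block n 2 1 \<in> B"
    using mult[OF E2 A] by simp
  \<comment> \<open>The middle block \<open>k\<close> is a single vertex, so the product carries no
    factor; passing through block 3 would give \<open>n - 2\<close>.\<close>
  have prod: "(\<lambda>x y. \<Sum>z = 1..n. star_block n i k x z * star_block n k j z y) = star_block n i j"
    if "k \<in> {1, 2}" for i j k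
    unfolding sum using n that
    by (subst L0) (auto simp: star_block_def fun_eq_iff min_def)
  have b11: "star_block n 1 1 \<in> B"
    using mult[OF b12 b21] prod[of 2 1 1] by simp
  \<comment> \<open>Column 1 of \<open>A\<close> is the indicator of all leaves
    \<open>{2..n}\<close>; removing leaf 2 leaves the large block.\<close>
  have "star_block n 3 1 = (\<lambda>x y. (\<Sum>z = 1..n. ?A x z * star_block n 1 1 z y) - star_block n 2 1 x y)"
    unfolding sum using n
    by (subst L0) (auto simp: star_block_def adj_mat_def star_edge_iff fun_eq_iff min_def)
  then have b31: "star_block n 3 1 \<in> B"
    using diff[OF mult[OF A b11] b21] by simp
  have "star_block n 1 3 = (\<lambda>x y. (\<Sum>z = 1..n. star_block n 1 1 x z * ?A z y) - star_block n 1 2 x y)"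
    unfolding sum using n
    by (subst L0) (auto simp: star_block_def adj_mat_def star_edge_iff fun_eq_iff min_def)
  then have b13: "star_block n 1 3 \<in> B"
    using diff[OF mult[OF b11 A] b12] by simp
  have "i = 1 \<or> i = 2 \<or> i = 3" "j = 1 \<or> j = 2 \<or> j = 3"
    using ij by auto
  then have "star_block n i 1 \<in> B" "star_block n 1 j \<in> B"
    using b11 b12 b13 b21 b31 by auto
  then show ?thesis
    using mult[of "star_block n i 1" "star_block n 1 j"] prod[of 1 i j] by simp
qed

lemma range_subset_T1_star:
  assumes "n \<ge> 4"
  shows "range (star_embed n) \<subseteq> carrier (T1 {1..n} (star_edges n) 2)"
proof -
  have "star_embed n (N, d) \<in> B"
    if B: "unital_subalgebra B (mat_alg {1..n})" and gens: "adj_mat (star_edges n) \<in> B" "diag_proj {2} \<in> B"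
    for B N d
  proof -
    note D = unital_subalgebra_matD[OF B]
    define m :: complex where "m = of_nat n - 2"
    \<comment> \<open>These are the block coefficients left after splitting off \<open>d\<close>
      times the identity: \<open>- d / m\<close> on the large block completes the projection, and
      \<open>- d\<close> at 1 and 2 cancels the identity there.\<close>
    define c where "c = (\<lambda>i j. N i j * (if j = 3 then 1 / m else 1)
      - (if i = 3 \<and> j = 3 then d / m else if i = j then d else 0))"
    have summand: "(\<lambda>x y. c i j * star_block n i j x y) \<in> B" if "i \<in> {1..3}" "j \<in> {1..3}" for i j
      using D(4) star_block_mem_subalgebra[OF assms B gens that] by blast
    have row: "(\<lambda>x y. \<Sum>j = 1..3. c i j * star_block n i j x y) \<in> B" if "i \<in> {1..3}" for i
      unfolding sum_3 using that by (intro D(3) summand) auto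
    have "(\<lambda>x y. \<Sum>i = 1..3. \<Sum>j = 1..3. c i j * star_block n i j x y) \<in> B"
      by (subst sum_3) (intro D(3) row; simp)
    then have "(\<lambda>x y. (\<Sum>i = 1..3. \<Sum>j = 1..3. c i j * star_block n i j x y)
        + d * (if x \<in> {1..n} \<and> x = y then 1 else 0)) \<in> B"
      by (rule D(3)[OF _ D(4)[OF D(1)]])
    moreover have "(\<Sum>i = 1..3. \<Sum>j = 1..3. c i j * star_block n i j x y)
        + d * (if x \<in> {1..n} \<and> x = y then 1 else 0) = star_embed n (N, d) x y" for x y
    proof (cases "x \<in> {1..n} \<and> y \<in> {1..n}")
      case True
      have "min x 3 \<in> {1, 2, 3}" "min y 3 \<in> {1, 2, 3}"
        using True by auto
      with True have "(\<Sum>i = 1..3. \<Sum>j = 1..3. c i j * star_block n i j x y) = c (min x 3) (min y 3)"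
        unfolding sum_3 star_block_def by auto
      with True show ?thesis
        by (auto simp: c_def star_embed_def m_def[symmetric] min_def algebra_simps)
    qed (auto simp: star_block_def star_embed_def)
    ultimately show ?thesis
      by simp
  qed
  then show ?thesis
    by (auto simp: T1_def generated_alg_def)
qed

theorem theorem7p6:
  fixes n :: nat
  assumes "n \<ge> 4"
  shows "T1 (star_vertices n) (star_edges n) 2 \<cong>\<^sub>\<C> mat_alg {1..3::nat} \<oplus>\<^sub>\<C> complex_alg \<and>
         T2 (star_vertices n) (star_edges n) 2 \<cong>\<^sub>\<C> mat_alg {1..3::nat} \<oplus>\<^sub>\<C> complex_alg \<and>
         T3 (star_vertices n) (star_edges n) 2 \<cong>\<^sub>\<C> mat_alg {1..3::nat} \<oplus>\<^sub>\<C> complex_alg \<and>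
         T4 (star_vertices n) (star_edges n) 2 \<cong>\<^sub>\<C> mat_alg {1..3::nat} \<oplus>\<^sub>\<C> complex_alg"
proof -
  let ?X = "star_vertices n" and ?E = "star_edges n"
  let ?B = "mat_alg {1..3::nat} \<oplus>\<^sub>\<C> complex_alg"
  let ?R = "star_embed n ` carrier ?B"
  have graph: "finite_connected_simple_graph ?X ?E" and two: "2 \<in> ?X"
    using assms star_finite_connected_simple_graph by (auto simp: star_vertices_def)
  have R1: "?R \<subseteq> carrier (T1 ?X ?E 2)"
    using range_subset_T1_star[OF assms] by (auto simp: star_vertices_def)
  have "carrier (T4 ?X ?E 2) \<subseteq> ?R"
    using T4_star_subset_range[OF assms] by (simp add: star_vertices_def)
  \<comment> \<open>The image lies in \<open>T1\<close>, and \<open>T4\<close> lies in the image, so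
    both chains of inclusions collapse to equalities.\<close>
  with R1 T1_subset_T2[OF graph two] T1_subset_T3[OF two, of ?E]
    T2_subset_T4[OF graph two] T3_subset_T4[OF graph two]
  have carriers: "carrier (T1 ?X ?E 2) = ?R" "carrier (T2 ?X ?E 2) = ?R"
      "carrier (T3 ?X ?E 2) = ?R" "carrier (T4 ?X ?E 2) = ?R"
    by blast+
  have iso: "(mat_alg {1..n})\<lparr>carrier := ?R\<rparr> \<cong>\<^sub>\<C> ?B"
  proof (rule alg_isoI_inv)
    show "star_embed n \<in> ring_hom ?B ((mat_alg {1..n})\<lparr>carrier := ?R\<rparr>)"
      using star_embed_hom[of n] assms by (auto simp: ring_hom_def)
    show "bij_betw (star_embed n) (carrier ?B) (carrier ((mat_alg {1..n})\<lparr>carrier := ?R\<rparr>))"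
      using star_embed_inj[OF assms] by (simp add: bij_betw_def)
    show "star_embed n (c \<odot>\<^bsub>?B\<^esub> b) = c \<odot>\<^bsub>(mat_alg {1..n})\<lparr>carrier := ?R\<rparr>\<^esub> star_embed n b" for c b
      by (cases b) (auto simp: alg_dirsum_simps star_embed_def fun_eq_iff algebra_simps)
  qed (auto simp: alg_dirsum_simps)
  \<comment> \<open>All four records are \<open>mat_alg\<close> with only the carrier replaced, so
    equal carriers make them equal as algebras.\<close>
  have "T1 ?X ?E 2 = (mat_alg {1..n})\<lparr>carrier := ?R\<rparr>" "T2 ?X ?E 2 = (mat_alg {1..n})\<lparr>carrier := ?R\<rparr>"
      "T3 ?X ?E 2 = (mat_alg {1..n})\<lparr>carrier := ?R\<rparr>" "T4 ?X ?E 2 = (mat_alg {1..n})\<lparr>carrier := ?R\<rparr>"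
    using carriers unfolding T1_def T2_def T3_def T4_def generated_alg_def
    by (simp_all add: star_vertices_def)
  with iso show ?thesis by simp
qed

end
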